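(* Let $G$ and $H$ be finite simple graphs with $G\in\mathfrak{F}$. Then $\gamma_R(G\boxtimes H)\ge \gamma(G)\gamma_R(H)$.
   Context: $\gamma(X)$ denotes the domination number of a graph $X$ (minimum size of a set $D$ such that every vertex outside $D$ has a neighbor in $D$). A Roman dominating function on $X$ is a map $f:V(X)\to\{0,1,2\}$ such that every vertex $v$ with $f(v)=0$ has a neighbor $u$ with $f(u)=2$; $\gamma_R(X)$ is the minimum of $\sum_v f(v)$ over such $f$. $\mathfrak{F}$ is the class of graphs $G$ having a dominating set $S=\{u_1,\dots,u_{\gamma(G)}\}$ of size $\gamma(G)$ with $N[u_i]\cap N[u_j]=\emptyset$ for all $i\ne j$, where $N[u]$ is the closed neighborhood of $u$. The strong product $G\boxtimes H$ has vertex set $V(G)\times V(H)$, with distinct $(g,h),(g',h')$ adjacent iff ($g=g'$ and $h\sim h'$) or ($g\sim g'$ and $h=h'$) or ($g\sim g'$ and $h\sim h'$). *)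

theory Defs
  imports "Graph_Theory.Pair_Digraph"
begin

text \<open>
  Finite simple graphs are represented by \<^locale>\<open>pair_graph\<close>: finite, loop-free, symmetric
  sets of arcs, so an undirected edge is a pair of opposite arcs. The vertex set may be empty.
\<close>

definition closed_nbhd :: "'a pair_pre_digraph \<Rightarrow> 'a \<Rightarrow> 'a set" where
  "closed_nbhd G u = insert u {v. (u, v) \<in> parcs G}"

definition dominating_set :: "'a pair_pre_digraph \<Rightarrow> 'a set \<Rightarrow> bool" where
  "dominating_set G D \<longleftrightarrow>
     D \<subseteq> pverts G \<and> (\<forall>v \<in> pverts G - D. \<exists>u \<in> D. (v, u) \<in> parcs G)"

definition domination_number :: "'a pair_pre_digraph \<Rightarrow> nat" where
  "domination_number G = (LEAST k. \<exists>D. dominating_set G D \<and> card D = k)"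

text \<open>Only the values of \<^term>\<open>f\<close> on the vertex set matter.\<close>

definition roman_dominating :: "'a pair_pre_digraph \<Rightarrow> ('a \<Rightarrow> nat) \<Rightarrow> bool" where
  "roman_dominating G f \<longleftrightarrow>
     (\<forall>v \<in> pverts G. f v \<in> {0, 1, 2}) \<and>
     (\<forall>v \<in> pverts G. f v = 0 \<longrightarrow> (\<exists>u \<in> pverts G. (v, u) \<in> parcs G \<and> f u = 2))"

definition roman_domination_number :: "'a pair_pre_digraph \<Rightarrow> nat" where
  "roman_domination_number G =
     (LEAST k. \<exists>f. roman_dominating G f \<and> (\<Sum>v \<in> pverts G. f v) = k)"

definition class_F :: "'a pair_pre_digraph set" where
  "class_F = {G. \<exists>S. dominating_set G S \<and> card S = domination_number G \<and>
     (\<forall>u \<in> S. \<forall>v \<in> S. u \<noteq> v \<longrightarrow> closed_nbhd G u \<inter> closed_nbhd G v = {})}"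

definition strong_product ::
    "'a pair_pre_digraph \<Rightarrow> 'b pair_pre_digraph \<Rightarrow> ('a \<times> 'b) pair_pre_digraph" where
  "strong_product G H = \<lparr>
     pverts = pverts G \<times> pverts H,
     parcs = {((g, h), (g', h')) | g h g' h'.
       (g, h) \<in> pverts G \<times> pverts H \<and> (g', h') \<in> pverts G \<times> pverts H \<and>
       (g, h) \<noteq> (g', h') \<and>
       (g = g' \<and> (h, h') \<in> parcs H \<or>
        (g, g') \<in> parcs G \<and> h = h' \<or>
        (g, g') \<in> parcs G \<and> (h, h') \<in> parcs H)} \<rparr>"

lemma pair_graph_strong_product:
  assumes "pair_graph G" "pair_graph H"
  shows "pair_graph (strong_product G H)"
proof -
  interpret G: pair_graph G by fact
  interpret H: pair_graph H by fact
  have fin: "finite (pverts (strong_product G H))"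
    by (simp add: strong_product_def G.pair_finite_verts H.pair_finite_verts)
  have sub: "parcs (strong_product G H)
      \<subseteq> pverts (strong_product G H) \<times> pverts (strong_product G H)"
    by (auto simp: strong_product_def)
  have "sym (parcs (strong_product G H))"
    by (rule symI)
      (auto simp: strong_product_def intro: G.arcs_symmetric H.arcs_symmetric)
  then have "symmetric (strong_product G H)"
    by (simp add: symmetric_def)
  moreover have "fst e \<noteq> snd e" if "e \<in> parcs (strong_product G H)" for e
    using that by (auto simp: strong_product_def)
  moreover have "finite (parcs (strong_product G H))"
    using fin sub by (meson finite_SigmaI finite_subset)
  ultimately show ?thesis
    using fin sub by unfold_locales auto
qed

text \<open>Both minima range over nonempty sets, so the \<^const>\<open>Least\<close> terms are attained.\<close>

lemma dominating_set_pverts: "dominating_set G (pverts G)"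
  by (simp add: dominating_set_def)

lemma roman_dominating_const: "roman_dominating G (\<lambda>_. 1)"
  by (simp add: roman_dominating_def)

end

theory Submission
  imports Defs
begin

text \<open>
  Let \<open>f\<close> be a Roman dominating function of the strong product and \<open>u\<close> a vertex of \<open>G\<close>. The
  maximum of \<open>f\<close> over the fibre \<open>N[u] \<times> {h}\<close> is a Roman dominating function of \<open>H\<close>: if it
  vanishes at \<open>h\<close>, then \<open>(u, h)\<close> has a neighbour of value 2 in some \<open>N[u] \<times> {h'}\<close>, and
  \<open>h' \<noteq> h\<close> forces \<open>h' \<sim> h\<close>. So \<open>f\<close> has weight at least \<open>\<gamma>\<^sub>R(H)\<close> on \<open>N[u] \<times> V(H)\<close>, and these
  blocks are disjoint when \<open>u\<close> ranges over a dominating set that witnesses \<open>G \<in> \<FF>\<close>.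
\<close>

lemma roman_domination_number_le:
  "roman_dominating G f \<Longrightarrow> roman_domination_number G \<le> (\<Sum>v \<in> pverts G. f v)"
  unfolding roman_domination_number_def by (rule Least_le) blast

lemma roman_domination_number_attained:
  obtains f where "roman_dominating G f" "(\<Sum>v \<in> pverts G. f v) = roman_domination_number G"
proof -
  \<comment> \<open>The constant function 1 shows that the set under \<open>LEAST\<close> is
    nonempty, so its minimum is attained.\<close>
  have "\<exists>k f. roman_dominating G f \<and> (\<Sum>v \<in> pverts G. f v) = k"
    using roman_dominating_const by blast
  then have "\<exists>f. roman_dominating G f \<and> (\<Sum>v \<in> pverts G. f v) = roman_domination_number G"
    unfolding roman_domination_number_def by (rule LeastI_ex)
  then show thesis using that by blast
qed

lemma closed_nbhd_subset_pverts:
  assumes "pair_graph G" "u \<in> pverts G"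
  shows "closed_nbhd G u \<subseteq> pverts G"
proof -
  interpret pair_graph G by fact
  show ?thesis using assms(2) in_arcsD2 by (auto simp: closed_nbhd_def)
qed

text \<open>A maximum of values in {0, 1, 2} stays in {0, 1, 2}, which a sum need not do. Centring
  the fibre at \<open>u\<close> matters because every neighbour of \<open>(u, h)\<close> lies over
  the closed neighbourhood of \<open>u\<close>.\<close>

lemma roman_dominating_fibre_Max:
  assumes "pair_graph G" "u \<in> pverts G" and f: "roman_dominating (strong_product G H) f"
  shows "roman_dominating H (\<lambda>h. Max ((\<lambda>g. f (g, h)) ` closed_nbhd G u))"
    (is "roman_dominating H ?F")
proof -
  interpret pair_graph G by fact
  let ?N = "closed_nbhd G u"
  have N: "?N \<subseteq> pverts G" by (rule closed_nbhd_subset_pverts[OF assms(1,2)])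
  then have fin: "finite ?N" using pair_finite_verts finite_subset by blast
  have uN: "u \<in> ?N" by (simp add: closed_nbhd_def)
  have val: "f (g, h) \<in> {0, 1, 2}" if "g \<in> ?N" "h \<in> pverts H" for g h
  proof -
    have "(g, h) \<in> pverts (strong_product G H)" using that N by (auto simp: strong_product_def)
    then show ?thesis using f unfolding roman_dominating_def by blast
  qed
  have le: "f (g, h) \<le> ?F h" if "g \<in> ?N" for g h
    using fin that by simp
  have F_val: "?F h \<in> {0, 1, 2}" if "h \<in> pverts H" for h
  proof -
    have "?F h \<in> (\<lambda>g. f (g, h)) ` ?N" using fin uN by (intro Max_in) auto
    then obtain g where "g \<in> ?N" "?F h = f (g, h)" by blast
    then show ?thesis using val[of g h] that by simp
  qed
  have "\<exists>h' \<in> pverts H. (h, h') \<in> parcs H \<and> ?F h' = 2" if h: "h \<in> pverts H" and 0: "?F h = 0" for h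
  proof -
    have "f (u, h) = 0" using le[OF uN, of h] 0 by simp
    moreover have "(u, h) \<in> pverts (strong_product G H)"
      using assms(2) h by (simp add: strong_product_def)
    ultimately obtain g' h' where
      adj: "((u, h), (g', h')) \<in> parcs (strong_product G H)" and 2: "f (g', h') = 2"
      using f unfolding roman_dominating_def by (metis surj_pair)
    \<comment> \<open>Each of the three kinds of adjacency keeps the first coordinate in
      \<open>?N\<close> and either fixes the second or moves it along an edge of
      \<open>H\<close>.\<close>
    from adj have g': "g' \<in> ?N" and h': "h' \<in> pverts H" and "h' = h \<or> (h, h') \<in> parcs H"
      by (auto simp: strong_product_def closed_nbhd_def)
    moreover have "h' \<noteq> h" using le[OF g', of h] 0 2 by auto
    \<comment> \<open>The value 2 occurs in the fibre over \<open>h'\<close>, and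
      \<open>F_val\<close> allows nothing larger.\<close>
    moreover have "?F h' = 2" using le[OF g', of h'] 2 F_val[OF h'] by auto
    ultimately show ?thesis by blast
  qed
  then show ?thesis using F_val unfolding roman_dominating_def by blast
qed

lemma roman_domination_number_le_block:
  assumes "pair_graph G" "u \<in> pverts G" "roman_dominating (strong_product G H) f"
  shows "roman_domination_number H \<le> (\<Sum>g \<in> closed_nbhd G u. \<Sum>h \<in> pverts H. f (g, h))"
proof -
  interpret pair_graph G by fact
  let ?N = "closed_nbhd G u"
  have fin: "finite ?N"
    using closed_nbhd_subset_pverts[OF assms(1,2)] pair_finite_verts finite_subset by blast
  have "roman_domination_number H \<le> (\<Sum>h \<in> pverts H. Max ((\<lambda>g. f (g, h)) ` ?N))"
    by (rule roman_domination_number_le[OF roman_dominating_fibre_Max[OF assms]])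
  also have "\<dots> \<le> (\<Sum>h \<in> pverts H. \<Sum>g \<in> ?N. f (g, h))"
  proof (rule sum_mono)
    fix h
    have "?N \<noteq> {}" by (simp add: closed_nbhd_def)
    \<comment> \<open>The values are natural numbers, so each of them, in particular the largest, is
      at most their sum.\<close>
    then show "Max ((\<lambda>g. f (g, h)) ` ?N) \<le> (\<Sum>g \<in> ?N. f (g, h))"
      using fin by (auto intro!: member_le_sum)
  qed
  also have "\<dots> = (\<Sum>g \<in> ?N. \<Sum>h \<in> pverts H. f (g, h))"
    by (rule sum.swap)
  finally show ?thesis .
qed

theorem theorem26:
  fixes G :: "'a pair_pre_digraph" and H :: "'b pair_pre_digraph"
  assumes "pair_graph G" and "pair_graph H"
    and "G \<in> class_F"
  shows "roman_domination_number (strong_product G H)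
           \<ge> domination_number G * roman_domination_number H"
proof -
  interpret pair_graph G by fact
  from assms(3) obtain S where dom: "dominating_set G S"
    and card: "card S = domination_number G"
    and disj: "\<forall>u \<in> S. \<forall>v \<in> S. u \<noteq> v \<longrightarrow> closed_nbhd G u \<inter> closed_nbhd G v = {}"
    unfolding class_F_def by blast
  have S: "S \<subseteq> pverts G" using dom by (simp add: dominating_set_def)
  then have finS: "finite S" using pair_finite_verts finite_subset by blast
  have sub: "closed_nbhd G u \<subseteq> pverts G" if "u \<in> S" for u
    using closed_nbhd_subset_pverts[OF assms(1)] S that by blast
  then have finN: "\<forall>u \<in> S. finite (closed_nbhd G u)"
    using pair_finite_verts finite_subset by blast
  obtain f where f: "roman_dominating (strong_product G H) f"
    and weight: "(\<Sum>v \<in> pverts (strong_product G H). f v) = roman_domination_number (strong_product G H)"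
    by (rule roman_domination_number_attained)
  have "domination_number G * roman_domination_number H = (\<Sum>u \<in> S. roman_domination_number H)"
    by (simp add: card)
  also have "\<dots> \<le> (\<Sum>u \<in> S. \<Sum>g \<in> closed_nbhd G u. \<Sum>h \<in> pverts H. f (g, h))"
    using roman_domination_number_le_block[OF assms(1) _ f] S by (intro sum_mono) blast
  also have "\<dots> = (\<Sum>g \<in> (\<Union>u \<in> S. closed_nbhd G u). \<Sum>h \<in> pverts H. f (g, h))"
    by (rule sum.UNION_disjoint[OF finS finN disj, symmetric])
  \<comment> \<open>The neighbourhoods lie inside \<open>pverts G\<close>, and enlarging the index
    set adds only nonnegative terms.\<close>
  also have "\<dots> \<le> (\<Sum>g \<in> pverts G. \<Sum>h \<in> pverts H. f (g, h))"
    using sub by (intro sum_mono2) (auto simp: pair_finite_verts)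
  also have "\<dots> = roman_domination_number (strong_product G H)"
    unfolding weight[symmetric] by (simp add: sum.cartesian_product strong_product_def)
  finally show ?thesis .
qed

end
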